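(* Let $p\geq 3$ be a prime and let $M_p$ be the $p^2\times p^2$ matrix over $\mathbb{Z}_p$ defined below. Then $M_p$ has the following three properties: (1) every element of $\mathbb{Z}_p$ occurs exactly $p$ times in each row and exactly $p$ times in each column of $M_p$; (2) for every $i\in\mathbb{Z}_p$, any two distinct columns of the block $V_i$ have equal entries in exactly $p$ rows; (3) for all $0\leq i<j\leq p-1$, any column of $V_i$ and any column of $V_j$ have equal entries in exactly $p-1$ rows. Consequently, a GBTD$(p,p)$ can be obtained from $M_p$: taking the $p^2$ columns of $M_p$ as points, the $p\times(p^2-1)$ array whose cell in row $k\in\mathbb{Z}_p$ and column $r\in\{2,\dots,p^2\}$ is $\{c : (M_p)_{r,c}=k\}$ is a GBTD$(p,p)$. In particular, a GBTD$(p,p)$ exists for every prime $p\geq 3$.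
   Context: Throughout, $p\geq 3$ is a prime, $\mathbb{Z}_p$ is the field of integers modulo $p$ with elements represented by $0,\dots,p-1$ (so inequalities between elements refer to these representatives), and $+,\times$ denote operations in $\mathbb{Z}_p$. A $(v,k,\lambda)$-BIBD is a pair $(X,A)$ with $|X|=v$ and $A$ a collection of $k$-subsets (blocks) of $X$ such that every pair of distinct points lies in exactly $\lambda$ blocks. A GBTD$(k,m)$ (generalized balanced tournament design) is a $(km,k,k-1)$-BIBD $(X,A)$ whose $m(km-1)$ blocks can be arranged into an $m\times(km-1)$ array such that (i) every point of $X$ occurs in exactly one cell of each column, and (ii) every point of $X$ is contained in at most $k$ cells of each row. Notation: for $a\in\mathbb{Z}_p$, $\bar a$ denotes the length-$p$ vector $(a,a,\dots,a)$ and $\vec a$ the length-$p$ vector $(a,a+1,a+2,\dots,a+p-1)$. Definition of $M_p$: its $p^2$ columns are split into $p$ consecutive blocks $V_0,V_1,\dots,V_{p-1}$ of $p$ columns each (columns within each block indexed by $\mathbb{Z}_p$). Its $p^2$ rows are split into a first block $H^*$ of $p$ rows, indexed by $i\in\mathbb{Z}_p$, followed by blocks $H_0,H_1,\dots,H_{p-1}$ of $p-1$ rows each, the rows of each $H_i$ indexed by $l\in\{0,1,\dots,p-2\}$. Writing $(H_i,V_j)_l$ for the length-$p$ vector formed by row $l$ of $H_i$ restricted to the columns of $V_j$, the entries are: - row $i$ of $H^*$ is $(\bar i,\overline{i+1},\overline{i+2},\dots,\overline{i+p-1})$ (the $t$-th constant vector occupying block $V_t$); - for $i\in\mathbb{Z}_p$,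 $j\in\{0,\dots,p-2\}$, $l\in\{0,\dots,p-2\}$: $(H_i,V_j)_l=\overrightarrow{i\times(j+1)+j\times l}$; - for $i\in\mathbb{Z}_p$, $l\in\{0,\dots,p-2\}$: $(H_i,V_{p-1})_l=\overrightarrow{-l}$ if $l\geq i$, and $(H_i,V_{p-1})_l=\overrightarrow{-l+1}$ if $l<i$. Rows of $M_p$ are numbered $1,\dots,p^2$ from top (row 1 is row $0$ of $H^*$). *)

theory Defs
  imports
    "HOL-Computational_Algebra.Primes"
    "HOL-Library.Multiset"
    "Jordan_Normal_Form.Matrix"
begin

(* Blocks form a multiset: the pair counts in a BIBD are taken with multiplicity, and the
   designs built below do have repeated blocks. *)
definition bibd :: "nat \<Rightarrow> nat \<Rightarrow> nat \<Rightarrow> 'a set \<Rightarrow> 'a set multiset \<Rightarrow> bool" where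
  "bibd v k lam X A \<longleftrightarrow>
     finite X \<and> card X = v \<and>
     (\<forall>B\<in>#A. B \<subseteq> X \<and> card B = k) \<and>
     (\<forall>x\<in>X. \<forall>y\<in>X. x \<noteq> y \<longrightarrow> size {# B \<in># A. x \<in> B \<and> y \<in> B #} = lam)"

definition array_blocks :: "nat \<Rightarrow> nat \<Rightarrow> (nat \<Rightarrow> nat \<Rightarrow> 'a set) \<Rightarrow> 'a set multiset" where
  "array_blocks m n T = image_mset (\<lambda>(i, j). T i j) (mset_set ({..<m} \<times> {..<n}))"

definition gbtd_array ::
  "nat \<Rightarrow> nat \<Rightarrow> 'a set \<Rightarrow> 'a set multiset \<Rightarrow> (nat \<Rightarrow> nat \<Rightarrow> 'a set) \<Rightarrow> bool" where
  "gbtd_array k m X A T \<longleftrightarrow>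
     bibd (k * m) k (k - 1) X A \<and>
     array_blocks m (k * m - 1) T = A \<and>
     (\<forall>x\<in>X. \<forall>j<k * m - 1. \<exists>!i. i < m \<and> x \<in> T i j) \<and>
     (\<forall>x\<in>X. \<forall>i<m. card {j. j < k * m - 1 \<and> x \<in> T i j} \<le> k)"

definition gbtd :: "nat \<Rightarrow> nat \<Rightarrow> 'a set \<Rightarrow> 'a set multiset \<Rightarrow> bool" where
  "gbtd k m X A \<longleftrightarrow> (\<exists>T. gbtd_array k m X A T)"

(* Elements of Z_p are represented by the integers 0, ..., p - 1.  bar_vec and arrow_vec are the
   vectors (a, a, ..., a) and (a, a + 1, ..., a + p - 1) over Z_p. *)
definition bar_vec :: "nat \<Rightarrow> int \<Rightarrow> int vec" where
  "bar_vec p a = vec p (\<lambda>t. a mod int p)"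

definition arrow_vec :: "nat \<Rightarrow> int \<Rightarrow> int vec" where
  "arrow_vec p a = vec p (\<lambda>t. (a + int t) mod int p)"

(* Row l of the row block H_i restricted to the columns of V_j. *)
definition HV :: "nat \<Rightarrow> nat \<Rightarrow> nat \<Rightarrow> nat \<Rightarrow> int vec" where
  "HV p i j l =
     (if j < p - 1 then arrow_vec p (int i * (int j + 1) + int j * int l)
      else if l \<ge> i then arrow_vec p (- int l)
      else arrow_vec p (- int l + 1))"

(* Rows and columns are numbered from 0.  Rows 0, ..., p - 1 form H^*; row l of H_i is
   p + i (p - 1) + l; column t of V_j is j p + t. *)
definition row_part :: "nat \<Rightarrow> nat \<Rightarrow> nat \<Rightarrow> int vec" where
  "row_part p r j =
     (if r < p then bar_vec p (int r + int j)
      else HV p ((r - p) div (p - 1)) j ((r - p) mod (p - 1)))"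

definition M :: "nat \<Rightarrow> int mat" where
  "M p = mat (p\<^sup>2) (p\<^sup>2) (\<lambda>(r, c). row_part p r (c div p) $ (c mod p))"

definition V :: "nat \<Rightarrow> nat \<Rightarrow> nat set" where
  "V p j = {j * p..<(j + 1) * p}"

definition agreements :: "nat \<Rightarrow> nat \<Rightarrow> nat \<Rightarrow> nat set" where
  "agreements p c d = {r. r < p\<^sup>2 \<and> M p $$ (r, c) = M p $$ (r, d)}"

(* Row 0 of the matrix is dropped, so array column s comes from matrix row s + 1. *)
definition M_array :: "nat \<Rightarrow> nat \<Rightarrow> nat \<Rightarrow> nat set" where
  "M_array p k s = {c. c < p\<^sup>2 \<and> M p $$ (s + 1, c) = int k}"

end

theory Submission
  imports Defs "HOL-Number_Theory.Cong"
begin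

text \<open>
  Two columns of the same block agree exactly on \<open>H\<^sup>*\<close>, and columns of different blocks never
  agree there.  Below \<open>H\<^sup>*\<close>, columns \<open>t\<close> of \<open>V\<^sub>j\<close> and \<open>s\<close> of \<open>V\<^sub>k\<close> with \<open>j < k < p - 1\<close> agree in
  row \<open>l\<close> of \<open>H\<^sub>i\<close> iff \<open>(i + l) (j - k) = s - t\<close>, which determines \<open>i\<close> from \<open>l\<close>.  For \<open>k = p - 1\<close>
  the condition is \<open>(i + l) (j + 1) = s - t\<close> if \<open>i \<le> l\<close> and \<open>(i + l) (j + 1) = s - t + 1\<close>
  if \<open>l < i\<close>; since \<open>i + l\<close> is symmetric and \<open>p\<close> is odd, each of the two cases has
  \<open>(p - 1) / 2\<close> solutions, whatever the right-hand sides are.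
\<close>

section \<open>Counting solutions of congruences\<close>

text \<open>A unit modulo \<open>p\<close> permutes the residues. The offset \<open>b\<close> is
  there to absorb, when one index of an entry is solved for, every term in the other
  indices.\<close>

lemma ex1_linear_cong:
  fixes a b c :: int
  assumes "coprime a (int p)" "p > 0"
  shows "\<exists>!i. i < p \<and> [a * int i + b = c] (mod int p)"
proof -
  obtain x where x: "[a * x = 1] (mod int p)"
    using cong_solve_coprime_int assms(1) by blast
  define i where "i = nat ((x * (c - b)) mod int p)"
  have i: "int i = (x * (c - b)) mod int p" "i < p"
    using assms(2) by (auto simp: i_def nat_less_iff)
  have "[a * int i = a * (x * (c - b))] (mod int p)"
    unfolding i by (intro cong_mult cong_refl cong_mod_leftI)
  also have "[a * (x * (c - b)) = 1 * (c - b)] (mod int p)"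
    using cong_mult[OF x cong_refl] by (simp add: mult.assoc)
  finally have "[a * int i + b = c] (mod int p)"
    using cong_add[OF _ cong_refl, of "a * int i" "c - b" _ b] by simp
  moreover have "i' = i''"
    if "i' < p" "[a * int i' + b = c] (mod int p)" "i'' < p" "[a * int i'' + b = c] (mod int p)"
    for i' i''
  proof -
    have "[a * int i' + b = a * int i'' + b] (mod int p)"
      using that cong_trans cong_sym by blast
    then have "[int i' = int i''] (mod int p)"
      using cong_mult_lcancel[OF assms(1)] by (simp add: cong_add_rcancel)
    then show ?thesis using that by (simp add: cong_def)
  qed
  ultimately show ?thesis using i(2) by blast
qed

lemma card_pairs_unique_fst:
  assumes "\<And>l. l < n \<Longrightarrow> \<exists>!i. i < m \<and> Q i l"
  shows "card {(i, l). i < (m::nat) \<and> l < (n::nat) \<and> Q i l} = n"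
proof -
  have "bij_betw snd {(i, l). i < m \<and> l < n \<and> Q i l} {..<n}"
    unfolding bij_betw_def inj_on_def using assms by (force simp: image_iff)
  then show ?thesis using bij_betw_same_card by fastforce
qed

lemma card_pairs_swap:
  "card {(i, l). Q i l} = card {(i, l). Q l i}"
  by (rule bij_betw_same_card[where f = prod.swap])
     (auto simp: bij_betw_def inj_on_def image_iff)

lemma card_pairs_unique_snd:
  assumes "\<And>i. i < m \<Longrightarrow> \<exists>!l. l < n \<and> Q i l"
  shows "card {(i, l). i < (m::nat) \<and> l < (n::nat) \<and> Q i l} = m"
  using card_pairs_unique_fst[of m n "\<lambda>l i. Q i l"] assms
  by (subst card_pairs_swap) (simp add: conj_ac)

lemma finite_nat_pairs: "finite {(i, l). i < (m::nat) \<and> l < (n::nat) \<and> Q i l}"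
  by (rule finite_subset[of _ "{..<m} \<times> {..<n}"]) auto

text \<open>For odd \<open>p\<close> the number 2 is a unit, so \<open>2 * i = u\<close> has one
  solution. This is the only fixed point of the swap of \<open>i\<close> and \<open>l\<close> among
  the solutions of \<open>i + l = u\<close>.\<close>

lemma card_diagonal_sum_cong:
  assumes "odd p"
  shows "card {(i, l). i < p \<and> l < p \<and> l = i \<and> [int i + int l = u] (mod int p)} = 1"
    (is "card ?D = 1")
proof -
  have "coprime 2 (int p)" "p > 0" using assms odd_pos by auto
  then have "\<exists>!i. i < p \<and> [int i + int i = u] (mod int p)"
    using ex1_linear_cong[of 2 p 0 u] by simp
  then obtain i where "{i. i < p \<and> [int i + int i = u] (mod int p)} = {i}" by blast
  moreover have "?D = (\<lambda>i. (i, i)) ` {i. i < p \<and> [int i + int i = u] (mod int p)}"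
    by auto
  ultimately have "?D = {(i, i)}" by simp
  then show ?thesis by simp
qed

text \<open>There are \<open>p\<close> solutions in all, one for each \<open>l\<close>. The swap of
  coordinates exchanges those below and those above the diagonal and fixes one, so each side has
  half of the remaining \<open>p - 1\<close>.\<close>

lemma card_sum_cong_strict_pairs:
  assumes "odd p"
  shows "2 * card {(i, l). i < p \<and> l < p \<and> i < l \<and> [int i + int l = u] (mod int p)} + 1 = p"
    (is "2 * card ?L + 1 = p")
proof -
  let ?C = "\<lambda>i l. [int i + int l = u] (mod int p)"
  let ?G = "{(i, l). i < p \<and> l < p \<and> l < i \<and> ?C i l}"
  let ?D = "{(i, l). i < p \<and> l < p \<and> l = i \<and> ?C i l}"
  have pos: "p > 0" using assms odd_pos by blast
  have "card {(i, l). i < p \<and> l < p \<and> ?C i l} = p"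
    by (rule card_pairs_unique_fst)
       (use ex1_linear_cong[of 1 p _ u] pos in \<open>auto simp: add.commute\<close>)
  moreover have "card {(i, l). i < p \<and> l < p \<and> ?C i l} = card (?L \<union> ?G \<union> ?D)"
    by (rule arg_cong[where f = card]) auto
  moreover have "card (?L \<union> ?G \<union> ?D) = card ?L + card ?G + card ?D"
    by (subst card_Un_disjoint; (subst card_Un_disjoint)?) (auto simp: finite_nat_pairs)
  moreover have "card ?G = card ?L"
    by (subst card_pairs_swap) (simp add: conj_ac add.commute)
  moreover have "card ?D = 1" using card_diagonal_sum_cong[OF assms] .
  ultimately show ?thesis by linarith
qed

text \<open>The solutions with \<open>l < i\<close> have \<open>l < p - 1\<close> automatically and
  number \<open>(p - 1) / 2\<close>. Those with \<open>i <= l < p - 1\<close> gain the diagonal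
  solution but lose the one with \<open>l = p - 1\<close>, so they also number
  \<open>(p - 1) / 2\<close>. Neither count depends on the residue, which is why \<open>u\<close>
  and \<open>w\<close> may be unrelated.\<close>

lemma card_sum_cong_split:
  assumes "odd p"
  shows "card {(i, l). i < p \<and> l < p - 1 \<and>
           [int i + int l = (if i \<le> l then u else w)] (mod int p)} = p - 1"
proof -
  let ?C = "\<lambda>u i l. [int i + int l = u] (mod int p)"
  let ?L = "{(i, l). i < p \<and> l < p \<and> i < l \<and> ?C u i l}"
  let ?D = "{(i, l). i < p \<and> l < p \<and> l = i \<and> ?C u i l}"
  let ?A = "{(i, l). i < p \<and> l < p - 1 \<and> i \<le> l \<and> ?C u i l}"
  let ?E = "{(i, l). i < p \<and> l < p \<and> l = p - 1 \<and> ?C u i l}"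
  let ?G = "{(i, l). i < p \<and> l < p \<and> l < i \<and> ?C w i l}"
  have pos: "p > 0" using assms odd_pos by blast
  have "card ?D = 1" using card_diagonal_sum_cong[OF assms] .
  moreover have "card ?E = 1"
  proof -
    have "\<exists>!i. i < p \<and> [int i + int (p - 1) = u] (mod int p)"
      using ex1_linear_cong[of 1 p "int (p - 1)" u] pos by simp
    then obtain i where "{i. i < p \<and> ?C u i (p - 1)} = {i}" by blast
    moreover have "?E = (\<lambda>i. (i, p - 1)) ` {i. i < p \<and> ?C u i (p - 1)}"
      using pos by auto
    ultimately have "?E = {(i, p - 1)}" by simp
    then show ?thesis by simp
  qed
  moreover have "card (?L \<union> ?D) = card ?L + card ?D" "card (?A \<union> ?E) = card ?A + card ?E"
    by (subst card_Un_disjoint; auto simp: finite_nat_pairs)+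
  \<comment> \<open>Both sides are the solutions with \<open>i <= l < p\<close>: once split off at
    the diagonal, once at \<open>l = p - 1\<close>. As \<open>?D\<close> and \<open>?E\<close> are
    singletons, \<open>?A\<close> and \<open>?L\<close> have equal size.\<close>
  moreover have "?L \<union> ?D = ?A \<union> ?E" using pos by auto
  then have "card (?L \<union> ?D) = card (?A \<union> ?E)" by (rule arg_cong)
  moreover have "card ?G = card {(i, l). i < p \<and> l < p \<and> i < l \<and> ?C w i l}"
    by (subst card_pairs_swap) (simp add: conj_ac add.commute)
  moreover have "card (?A \<union> ?G) = card ?A + card ?G"
    by (rule card_Un_disjoint) (auto simp: finite_nat_pairs)
  moreover have "card {(i, l). i < p \<and> l < p - 1 \<and> ?C (if i \<le> l then u else w) i l} =
      card (?A \<union> ?G)"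
    by (rule arg_cong[where f = card]) (auto split: if_splits)
  ultimately show ?thesis
    using card_sum_cong_strict_pairs[OF assms, of u] card_sum_cong_strict_pairs[OF assms, of w]
    by linarith
qed

text \<open>This is the count for a column of the last block \<open>V p (p - 1)\<close>. With
  \<open>u\<close> the residue of \<open>- c\<close>, the case \<open>i <= l\<close> forces
  \<open>l = u\<close> and the case \<open>l < i\<close> forces \<open>l = u + 1\<close> modulo
  \<open>p\<close>; what remains is to count the admissible \<open>i\<close> in each.\<close>

lemma card_shifted_cong:
  assumes "p > 0"
  shows "card {(i, l). i < p \<and> l < p - 1 \<and>
           [(if i \<le> l then - int l else - int l + 1) = c] (mod int p)} = p - 1"
proof -
  define u where "u = nat ((- c) mod int p)"
  have u: "u < p" "int u = (- c) mod int p"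
    using assms by (auto simp: u_def nat_less_iff)
  have cu: "[c = - int u] (mod int p)"
    unfolding u(2) by (simp add: cong_def mod_minus_eq)
  have neg: "[- x = c] (mod int p) \<longleftrightarrow> [x = int u] (mod int p)" for x
    using cu by (metis cong_minus_minus_iff cong_sym cong_trans)
  have le: "[- int l = c] (mod int p) \<longleftrightarrow> l = u" if "l < p" for l
    using that u neg[of "int l"] by (auto simp: cong_def)
  \<comment> \<open>At \<open>u = p - 1\<close> the successor \<open>u + 1\<close> wraps around to
    0.\<close>
  have lt: "[- int l + 1 = c] (mod int p) \<longleftrightarrow> (if u = p - 1 then l = 0 else l = u + 1)"
    if "l < p" for l
  proof -
    have "[- int l + 1 = c] (mod int p) \<longleftrightarrow> [int l - 1 = int u] (mod int p)"
      using neg[of "int l - 1"] by simp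
    also have "\<dots> \<longleftrightarrow> [int l = int (u + 1)] (mod int p)"
      using cong_add_rcancel[of "int l - 1" 1 "int u" "int p"] by (simp add: add.commute)
    also have "\<dots> \<longleftrightarrow> (if u = p - 1 then l = 0 else l = u + 1)"
      using that u(1) assms unfolding cong_int_iff by (auto simp: cong_def)
    finally show ?thesis .
  qed
  have iff: "[(if i \<le> l then - int l else - int l + 1) = c] (mod int p) \<longleftrightarrow>
      (if i \<le> l then l = u else if u = p - 1 then l = 0 else l = u + 1)" if "l < p - 1" for i l
    using le[of l] lt[of l] that by simp
  have eq: "{(i, l). i < p \<and> l < p - 1 \<and>
         [(if i \<le> l then - int l else - int l + 1) = c] (mod int p)} =
       {(i, l). i < p \<and> l < p - 1 \<and>
         (if i \<le> l then l = u else if u = p - 1 then l = 0 else l = u + 1)}"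
    by (simp only: iff cong: conj_cong)
  show ?thesis
  proof (cases "u = p - 1")
    case True
    then have "{(i, l). i < p \<and> l < p - 1 \<and>
         (if i \<le> l then l = u else if u = p - 1 then l = 0 else l = u + 1)} = {1..<p} \<times> {0}"
      by auto
    then show ?thesis unfolding eq by simp
  next
    \<comment> \<open>There are \<open>u + 1\<close> values \<open>i <= u\<close> for
      \<open>l = u\<close>, and \<open>p - u - 2\<close> values \<open>i > u + 1\<close> for
      \<open>l = u + 1\<close>. If \<open>u = p - 2\<close>, the second set is empty, in accordance
      with \<open>l < p - 1\<close>.\<close>
    case False
    then have "{(i, l). i < p \<and> l < p - 1 \<and>
         (if i \<le> l then l = u else if u = p - 1 then l = 0 else l = u + 1)} =
         {..u} \<times> {u} \<union> {u + 2..<p} \<times> {u + 1}"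
      using u(1) by (auto split: if_splits)
    moreover have "card ({..u} \<times> {u} \<union> {u + 2..<p} \<times> {u + 1}) = p - 1"
      using u(1) False by (subst card_Un_disjoint) auto
    ultimately show ?thesis unfolding eq by simp
  qed
qed

section \<open>Entries of \<open>M\<^sub>p\<close>\<close>

text \<open>Division with remainder by \<open>q\<close>. It serves the columns with
  \<open>q = p\<close> and the rows below \<open>H^*\<close> with \<open>q = p - 1\<close>.\<close>

lemma card_blockwise:
  fixes m q :: nat
  shows "card {n. n < m * q \<and> P n} = card {(i, t). i < m \<and> t < q \<and> P (i * q + t)}"
proof -
  have "{n. n < m * q \<and> P n} = (\<lambda>(i, t). i * q + t) ` {(i, t). i < m \<and> t < q \<and> P (i * q + t)}"
  proof safe
    fix n assume n: "n < m * q" "P n"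
    then have "q > 0" by (cases q) auto
    then have "n div q < m" "n mod q < q" "n = n div q * q + n mod q"
      using n by (auto simp: less_mult_imp_div_less)
    then show "n \<in> (\<lambda>(i, t). i * q + t) ` {(i, t). i < m \<and> t < q \<and> P (i * q + t)}"
      using n(2) by (intro image_eqI[of _ _ "(n div q, n mod q)"]) auto
  next
    fix i t assume "i < m" "t < q"
    then have "Suc i * q \<le> m * q" by (intro mult_le_mono1) simp
    then show "i * q + t < m * q" using \<open>t < q\<close> by simp
  qed
  moreover have "inj_on (\<lambda>(i, t). i * q + t) {(i, t). i < m \<and> t < q \<and> P (i * q + t)}"
  proof (rule inj_onI, clarify)
    fix i t i' t' assume *: "t < q" "t' < q" "i * q + t = i' * q + t'"
    have "(i * q + t) div q = i" "(i' * q + t') div q = i'"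
         "(i * q + t) mod q = t" "(i' * q + t') mod q = t'" using *(1,2) by auto
    then show "i = i' \<and> t = t'" using *(3) by simp
  qed
  ultimately show ?thesis by (simp add: card_image)
qed

lemma square_split: "p\<^sup>2 = p + p * (p - 1)" for p :: nat
  by (cases p) (auto simp: power2_eq_square)

lemma card_rows:
  fixes p :: nat
  shows "card {r. r < p\<^sup>2 \<and> P r} =
     card {r. r < p \<and> P r} + card {(i, l). i < p \<and> l < p - 1 \<and> P (p + i * (p - 1) + l)}"
proof -
  have "{r. r < p\<^sup>2 \<and> P r} = {r. r < p \<and> P r} \<union> (+) p ` {n. n < p * (p - 1) \<and> P (p + n)}"
  proof -
    have "r \<in> (+) p ` {n. n < p * (p - 1) \<and> P (p + n)}" if "r < p\<^sup>2" "P r" "\<not> r < p" for r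
      using that by (intro image_eqI[of _ _ "r - p"]) (auto simp: square_split)
    then show ?thesis by (auto simp: square_split)
  qed
  then have "card {r. r < p\<^sup>2 \<and> P r} =
      card {r. r < p \<and> P r} + card ((+) p ` {n. n < p * (p - 1) \<and> P (p + n)})"
    by (simp only:) (rule card_Un_disjoint; auto)
  then show ?thesis by (simp add: card_image card_blockwise add.assoc)
qed

text \<open>The first entry of the arrow vector \<open>HV p i j l\<close>, left unreduced so that
  congruences between entries become linear algebra over the integers.\<close>

definition arrow_start :: "nat \<Rightarrow> nat \<Rightarrow> nat \<Rightarrow> nat \<Rightarrow> int" where
  "arrow_start p i j l =
     (if j < p - 1 then int i * (int j + 1) + int j * int l
      else if i \<le> l then - int l else - int l + 1)"

lemma col_less: "j < p \<Longrightarrow> t < p \<Longrightarrow> j * p + t < p\<^sup>2" for p :: nat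
  using mult_le_mono1[of "Suc j" p p] by (simp add: power2_eq_square)

lemma M_top:
  assumes "r < p" "j < p" "t < p"
  shows "M p $$ (r, j * p + t) = (int r + int j) mod int p"
proof -
  have "r < p\<^sup>2" using assms by (metis less_le_trans le_square power2_eq_square)
  then show ?thesis
    using assms col_less[of j p t] by (simp add: M_def row_part_def bar_vec_def)
qed

lemma M_low:
  assumes "i < p" "l < p - 1" "j < p" "t < p"
  shows "M p $$ (p + i * (p - 1) + l, j * p + t) = (arrow_start p i j l + int t) mod int p"
proof -
  have "Suc i * (p - 1) \<le> p * (p - 1)" using assms by (intro mult_le_mono1) simp
  then have "p + i * (p - 1) + l < p\<^sup>2" using assms by (simp add: square_split)
  then show ?thesis
    using assms col_less[of j p t]
    by (auto simp: M_def row_part_def arrow_vec_def HV_def arrow_start_def)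
qed

(* simp normalises p - 1 to p - Suc 0, where M_low no longer matches. *)
lemmas M_low_Suc = M_low[unfolded One_nat_def]

lemma row_cases:
  fixes r p :: nat
  assumes "r < p\<^sup>2"
  obtains "r < p" | i l where "i < p" "l < p - 1" "r = p + i * (p - 1) + l"
proof (cases "r < p")
  case False
  have lt: "r - p < p * (p - 1)" using assms False by (simp add: square_split)
  then have "p - 1 > 0" by (cases "p - 1") auto
  moreover have "(r - p) div (p - 1) < p" using lt by (simp add: less_mult_imp_div_less)
  moreover have "r = p + (r - p) div (p - 1) * (p - 1) + (r - p) mod (p - 1)"
    using False div_mult_mod_eq[of "r - p" "p - 1"] by linarith
  ultimately show ?thesis
    using that(2)[of "(r - p) div (p - 1)" "(r - p) mod (p - 1)"] mod_less_divisor by blast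
qed (use that in blast)

lemma V_cases:
  assumes "c \<in> V p j"
  obtains t where "t < p" "c = j * p + t"
  using assms that[of "c - j * p"] by (auto simp: V_def)

lemma col_cases:
  fixes c p :: nat
  assumes "c < p\<^sup>2"
  obtains j where "j < p" "c \<in> V p j"
proof -
  have "p > 0" using assms by (cases p) auto
  moreover have "c div p < p" using assms by (simp add: less_mult_imp_div_less power2_eq_square)
  moreover have "c \<in> V p (c div p)"
    using \<open>p > 0\<close> by (auto simp: V_def dividend_less_div_times)
  ultimately show ?thesis using that by blast
qed

section \<open>The three properties\<close>

text \<open>In a row of \<open>H^*\<close> the value fills a single block, so \<open>t\<close>
  determines \<open>j\<close>. In a lower row each block runs through all residues once, so
  \<open>j\<close> determines \<open>t\<close>.\<close>

lemma card_row_occurrences: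
  assumes "r < p\<^sup>2" "a \<in> {0..<int p}"
  shows "card {c. c < p\<^sup>2 \<and> M p $$ (r, c) = a} = p"
proof -
  \<comment> \<open>Since \<open>a\<close> is its own residue, an entry equals \<open>a\<close> iff
    the two are congruent.\<close>
  have pos: "p > 0" and a: "a = a mod int p" using assms by auto
  have "card {c. c < p\<^sup>2 \<and> M p $$ (r, c) = a} =
      card {(j, t). j < p \<and> t < p \<and> M p $$ (r, j * p + t) = a}"
    using card_blockwise[of p p] by (simp add: power2_eq_square)
  also have "\<dots> = p"
    using assms(1)
  proof (cases rule: row_cases)
    case 1
    have "\<exists>!j. j < p \<and> M p $$ (r, j * p + t) = a" if "t < p" for t
      using ex1_linear_cong[of 1 p "int r" a] pos that 1 a
      by (auto simp: M_top cong_def add.commute[of "int r"] cong: conj_cong)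
    then show ?thesis by (rule card_pairs_unique_fst)
  next
    case (2 i l)
    have "\<exists>!t. t < p \<and> M p $$ (r, j * p + t) = a" if "j < p" for j
      using ex1_linear_cong[of 1 p "arrow_start p i j l" a] pos that 2 a
      by (auto simp: M_low_Suc cong_def add.commute[of "arrow_start p i j l"] cong: conj_cong)
    then show ?thesis by (rule card_pairs_unique_snd)
  qed
  finally show ?thesis .
qed

text \<open>Primality of \<open>p\<close> enters here: it makes the coefficients
  \<open>j + 1\<close> (for \<open>j < p - 1\<close>) and \<open>i - j\<close> (for distinct blocks)
  units.\<close>

lemma coprime_prime_int:
  fixes a :: int
  assumes "prime p" "a \<noteq> 0" "\<bar>a\<bar> < int p"
  shows "coprime a (int p)"
proof -
  have "\<not> int p dvd a" using assms zdvd_not_zless[of "\<bar>a\<bar>" "int p"] by auto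
  then show ?thesis
    using assms(1) prime_imp_coprime[of "int p" a] by (simp add: coprime_commute)
qed

text \<open>\<open>H^*\<close> contributes one occurrence and the lower rows \<open>p - 1\<close>.
  For \<open>j < p - 1\<close> the coefficient \<open>j + 1\<close> of \<open>i\<close> is a unit,
  so each \<open>l\<close> admits one \<open>i\<close>; the last block is the case of
  \<open>card_shifted_cong\<close>.\<close>

lemma card_column_occurrences:
  assumes "prime p" "c < p\<^sup>2" "a \<in> {0..<int p}"
  shows "card {r. r < p\<^sup>2 \<and> M p $$ (r, c) = a} = p"
proof -
  have pos: "p > 0" and a: "a = a mod int p" using assms by auto
  obtain j where j: "j < p" "c \<in> V p j" using assms(2) by (rule col_cases)
  then obtain t where t: "t < p" "c = j * p + t" by (elim V_cases)
  have "\<exists>!r. r < p \<and> M p $$ (r, c) = a"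
    using ex1_linear_cong[of 1 p "int j" a] pos a t j
    by (auto simp: M_top cong_def cong: conj_cong)
  then obtain r where "{r. r < p \<and> M p $$ (r, c) = a} = {r}" by blast
  then have top: "card {r. r < p \<and> M p $$ (r, c) = a} = 1" by simp
  have "{(i, l). i < p \<and> l < p - 1 \<and> M p $$ (p + i * (p - 1) + l, c) = a} =
      {(i, l). i < p \<and> l < p - 1 \<and> [arrow_start p i j l + int t = a] (mod int p)}"
    using a t j by (auto simp: M_low_Suc cong_def)
  also have "card \<dots> = p - 1"
  proof (cases "j < p - 1")
    case True
    then have "coprime (int j + 1) (int p)" using assms(1) by (intro coprime_prime_int) auto
    then have "\<exists>!i. i < p \<and> [arrow_start p i j l + int t = a] (mod int p)" for l
      using ex1_linear_cong[of "int j + 1" p "int j * int l + int t" a] pos True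
      by (simp add: arrow_start_def algebra_simps)
    then show ?thesis by (intro card_pairs_unique_fst)
  next
    case False
    have "[x + int t = a] (mod int p) \<longleftrightarrow> [x = a - int t] (mod int p)" for x
      by (simp add: cong_iff_dvd_diff algebra_simps)
    then show ?thesis
      using card_shifted_cong[OF pos, of "a - int t"] False by (simp add: arrow_start_def)
  qed
  finally show ?thesis using top pos by (simp add: card_rows)
qed

lemma card_agreements_same_block:
  assumes "i < p" "c \<in> V p i" "d \<in> V p i" "c \<noteq> d"
  shows "card (agreements p c d) = p"
proof -
  obtain s t where st: "s < p" "c = i * p + s" "t < p" "d = i * p + t"
    using assms(2,3) by (elim V_cases)
  then have ne: "s \<noteq> t" using assms(4) by auto
  have "{r. r < p \<and> M p $$ (r, c) = M p $$ (r, d)} = {..<p}"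
    using st assms(1) by (auto simp: M_top)
  \<comment> \<open>The entries of one arrow vector are pairwise distinct, so no lower row is an
    agreement.\<close>
  moreover have "(x + int s) mod int p \<noteq> (x + int t) mod int p" for x
    using st ne cong_add_lcancel[of x "int s" "int t" "int p"] by (auto simp: cong_def)
  then have "{(k, l). k < p \<and> l < p - 1 \<and>
      M p $$ (p + k * (p - 1) + l, c) = M p $$ (p + k * (p - 1) + l, d)} = {}"
    using st assms(1) by (auto simp: M_low_Suc)
  ultimately show ?thesis by (simp only: agreements_def card_rows) simp
qed

lemma top_row_disagree:
  assumes "i < p" "j < p" "i \<noteq> j" "c \<in> V p i" "d \<in> V p j" "r < p"
  shows "M p $$ (r, c) \<noteq> M p $$ (r, d)"
proof -
  obtain s t where st: "s < p" "c = i * p + s" "t < p" "d = j * p + t"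
    using assms(4,5) by (elim V_cases)
  have "\<not> [int r + int i = int r + int j] (mod int p)"
    using assms by (subst cong_add_lcancel) (auto simp: cong_def)
  then show ?thesis using st assms by (auto simp: M_top cong_def)
qed

lemma card_agreements_distinct_blocks:
  assumes "prime p" "p \<ge> 3" "i < j" "j < p" "c \<in> V p i" "d \<in> V p j"
  shows "card (agreements p c d) = p - 1"
proof -
  have pos: "p > 0" and odd: "odd p" using assms prime_odd_nat[of p] by auto
  obtain s t where st: "s < p" "c = i * p + s" "t < p" "d = j * p + t"
    using assms(5,6) by (elim V_cases)
  have top: "{r. r < p \<and> M p $$ (r, c) = M p $$ (r, d)} = {}"
    using assms top_row_disagree[of i p j c d] by auto
  have low: "{(k, l). k < p \<and> l < p - 1 \<and>
        M p $$ (p + k * (p - 1) + l, c) = M p $$ (p + k * (p - 1) + l, d)} =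
      {(k, l). k < p \<and> l < p - 1 \<and>
        [arrow_start p k i l + int s = arrow_start p k j l + int t] (mod int p)}"
    using st assms by (auto simp: M_low_Suc cong_def)
  have "card {(k, l). k < p \<and> l < p - 1 \<and>
        [arrow_start p k i l + int s = arrow_start p k j l + int t] (mod int p)} = p - 1"
  proof (cases "j < p - 1")
    case True
    have "coprime (int i - int j) (int p)" using assms by (intro coprime_prime_int) auto
    from ex1_linear_cong[OF this pos, of "(int i - int j) * int l" "int t - int s" for l]
    \<comment> \<open>The starts \<open>k * (i + 1) + i * l\<close> and
      \<open>k * (j + 1) + j * l\<close> differ by \<open>(i - j) * (k + l)\<close>.\<close>
    moreover have "[arrow_start p k i l + int s = arrow_start p k j l + int t] (mod int p) \<longleftrightarrow>
        [(int i - int j) * int k + (int i - int j) * int l = int t - int s] (mod int p)" for k l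
      using True assms(3) by (simp add: arrow_start_def cong_iff_dvd_diff algebra_simps)
    ultimately have
      "\<exists>!k. k < p \<and> [arrow_start p k i l + int s = arrow_start p k j l + int t] (mod int p)" for l
      by simp
    then show ?thesis by (intro card_pairs_unique_fst)
  next
    case False
    \<comment> \<open>Now \<open>j = p - 1\<close>, so \<open>i + 1 < p\<close> is a unit. Dividing
      by it turns the right-hand sides of the two cases into \<open>u\<close> and
      \<open>w\<close>.\<close>
    have cop: "coprime (int i + 1) (int p)" using assms by (intro coprime_prime_int) auto
    obtain u where u: "[(int i + 1) * int u = int t - int s] (mod int p)"
      using ex1_linear_cong[OF cop pos, of 0 "int t - int s"] by auto
    obtain w where w: "[(int i + 1) * int w = int t - int s + 1] (mod int p)"
      using ex1_linear_cong[OF cop pos, of 0 "int t - int s + 1"] by auto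
    have "[arrow_start p k i l + int s = arrow_start p k j l + int t] (mod int p) \<longleftrightarrow>
        [int k + int l = (if k \<le> l then int u else int w)] (mod int p)" for k l
    proof -
      \<comment> \<open>Moving the \<open>- l\<close> of the last block to the other side completes
        \<open>i * l\<close> to \<open>(i + 1) * l\<close>, so the left side depends on
        \<open>k + l\<close> only.\<close>
      have "[arrow_start p k i l + int s = arrow_start p k j l + int t] (mod int p) \<longleftrightarrow>
          [(int i + 1) * (int k + int l) =
            (if k \<le> l then int t - int s else int t - int s + 1)] (mod int p)"
        using False assms(3,4) by (simp add: arrow_start_def cong_iff_dvd_diff algebra_simps)
      also have "\<dots> \<longleftrightarrow> [(int i + 1) * (int k + int l) =
            (int i + 1) * (if k \<le> l then int u else int w)] (mod int p)"
        using u w by (auto intro: cong_trans cong_sym)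
      finally show ?thesis using cong_mult_lcancel[OF cop] by simp
    qed
    then show ?thesis using card_sum_cong_split[OF odd] by simp
  qed
  then show ?thesis using top low by (simp only: agreements_def card_rows) simp
qed

section \<open>The tournament design\<close>

lemma M_range:
  assumes "p > 0" "r < p\<^sup>2" "c < p\<^sup>2"
  shows "M p $$ (r, c) \<in> {0..<int p}"
proof -
  obtain j where j: "j < p" "c \<in> V p j" using assms(3) by (rule col_cases)
  then obtain t where "t < p" "c = j * p + t" by (elim V_cases)
  with assms(2) show ?thesis
    by (cases rule: row_cases) (use j assms(1) in \<open>auto simp: M_top M_low_Suc\<close>)
qed

text \<open>Counting cells rather than sets respects multiplicity: equal blocks in different cells
  count separately.\<close>

lemma size_filter_array_blocks:
  "size {# B \<in># array_blocks m n T. P B #} = card {(i, j). i < m \<and> j < n \<and> P (T i j)}"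
proof -
  have "{x \<in> {..<m} \<times> {..<n}. P (case x of (i, j) \<Rightarrow> T i j)} =
      {(i, j). i < m \<and> j < n \<and> P (T i j)}" by auto
  then show ?thesis
    by (simp add: array_blocks_def filter_mset_image_mset filter_mset_mset_set)
qed

text \<open>Two distinct columns agree in row 0 exactly when they lie in the same block, so dropping
  that row equalises the two agreement counts.\<close>

lemma card_agreements_drop_row:
  assumes "prime p" "p \<ge> 3" "c < p\<^sup>2" "d < p\<^sup>2" "c \<noteq> d"
  shows "card (agreements p c d - {0}) = p - 1"
proof -
  obtain i where i: "i < p" "c \<in> V p i" using assms(3) by (rule col_cases)
  obtain j where j: "j < p" "d \<in> V p j" using assms(4) by (rule col_cases)
  have fin: "finite (agreements p c d)" by (simp add: agreements_def)
  show ?thesis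
  proof (cases "i = j")
    case True
    have "0 \<in> agreements p c d"
      using i j True assms by (auto simp: agreements_def M_top elim!: V_cases)
    moreover have "card (agreements p c d) = p"
      using card_agreements_same_block[of i p c d] i j True assms(5) by simp
    ultimately show ?thesis using fin by simp
  next
    case False
    have "0 \<notin> agreements p c d"
      using top_row_disagree[of i p j c d 0] i j False by (auto simp: agreements_def)
    moreover have "agreements p c d = agreements p d c" by (auto simp: agreements_def)
    then have "card (agreements p c d) = p - 1"
      using card_agreements_distinct_blocks[OF assms(1,2)] i j False by (metis nat_neq_iff)
    ultimately show ?thesis by simp
  qed
qed

text \<open>A cell of array column \<open>s\<close> holds both points iff its row index
  \<open>k\<close> is their common entry in matrix row \<open>s + 1\<close>. So \<open>s\<close>
  determines the cell, and \<open>Suc s\<close> ranges over the agreements other than the dropped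
  row 0.\<close>

lemma card_common_cells:
  assumes "p > 0" "c < p\<^sup>2" "d < p\<^sup>2"
  shows "card {(k, s). k < p \<and> s < p\<^sup>2 - 1 \<and> c \<in> M_array p k s \<and> d \<in> M_array p k s} =
    card (agreements p c d - {0})"
proof (rule bij_betw_same_card[where f = "\<lambda>(k, s). Suc s"], unfold bij_betw_def, intro conjI)
  let ?S = "{(k, s). k < p \<and> s < p\<^sup>2 - 1 \<and> c \<in> M_array p k s \<and> d \<in> M_array p k s}"
  show "inj_on (\<lambda>(k, s). Suc s) ?S" by (auto simp: inj_on_def M_array_def)
  show "(\<lambda>(k, s). Suc s) ` ?S = agreements p c d - {0}"
  proof
    show "(\<lambda>(k, s). Suc s) ` ?S \<subseteq> agreements p c d - {0}"
      by (auto simp: M_array_def agreements_def)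
    show "agreements p c d - {0} \<subseteq> (\<lambda>(k, s). Suc s) ` ?S"
    proof
      fix r assume r: "r \<in> agreements p c d - {0}"
      \<comment> \<open>By \<open>M_range\<close> the entry is nonnegative and below
        \<open>p\<close>, so \<open>nat\<close> loses nothing and \<open>k\<close> is a row of the
        array.\<close>
      define k where "k = nat (M p $$ (r, c))"
      have "r < p\<^sup>2" "M p $$ (r, c) = M p $$ (r, d)" "r > 0"
        using r by (auto simp: agreements_def)
      moreover from this have "k < p" "int k = M p $$ (r, c)"
        using M_range[OF assms(1), of r c] assms(2) by (auto simp: k_def)
      ultimately show "r \<in> (\<lambda>(k, s). Suc s) ` ?S"
        using assms by (intro image_eqI[of _ _ "(k, r - 1)"]) (auto simp: M_array_def)
    qed
  qed
qed

lemma bibd_M_array: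
  assumes "prime p" "p \<ge> 3"
  shows "bibd (p * p) p (p - 1) {..<p\<^sup>2} (array_blocks p (p\<^sup>2 - 1) (M_array p))"
  unfolding bibd_def
proof (intro conjI ballI impI)
  fix B assume "B \<in># array_blocks p (p\<^sup>2 - 1) (M_array p)"
  then obtain k s where B: "k < p" "s < p\<^sup>2 - 1" "B = M_array p k s"
    by (auto simp: array_blocks_def)
  then show "B \<subseteq> {..<p\<^sup>2}" by (auto simp: M_array_def)
  show "card B = p"
    using B card_row_occurrences[of "s + 1" p "int k"] by (simp add: M_array_def)
next
  fix c d assume "c \<in> {..<p\<^sup>2}" "d \<in> {..<p\<^sup>2}" "c \<noteq> d"
  then show "size {# B \<in># array_blocks p (p\<^sup>2 - 1) (M_array p). c \<in> B \<and> d \<in> B #} = p - 1"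
    using card_common_cells[of p c d] card_agreements_drop_row[of p c d] assms
    by (simp add: size_filter_array_blocks)
qed (simp_all add: power2_eq_square)

lemma gbtd_array_M_array:
  assumes "prime p" "p \<ge> 3"
  shows "gbtd_array p p {..<p\<^sup>2} (array_blocks p (p\<^sup>2 - 1) (M_array p)) (M_array p)"
  unfolding gbtd_array_def
proof (intro conjI ballI allI impI)
  show "bibd (p * p) p (p - 1) {..<p\<^sup>2} (array_blocks p (p\<^sup>2 - 1) (M_array p))"
    using bibd_M_array[OF assms] .
  show "array_blocks p (p * p - 1) (M_array p) = array_blocks p (p\<^sup>2 - 1) (M_array p)"
    by (simp add: power2_eq_square)
  fix c assume c: "c \<in> {..<p\<^sup>2}"
  {
    fix s assume "s < p * p - 1"
    then have "M p $$ (s + 1, c) \<in> {0..<int p}"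
      using M_range[of p "s + 1" c] c assms(2) by (simp add: power2_eq_square)
    then show "\<exists>!k. k < p \<and> c \<in> M_array p k s"
      using c by (intro ex1I[of _ "nat (M p $$ (s + 1, c))"]) (auto simp: M_array_def)
  }
  fix k assume k: "k < p"
  \<comment> \<open>\<open>Suc\<close> embeds the array columns into the matrix rows. It misses row
    0, so for the entry of \<open>c\<close> in that row the inequality is strict.\<close>
  have "card {s. s < p * p - 1 \<and> c \<in> M_array p k s} \<le>
      card {r. r < p\<^sup>2 \<and> M p $$ (r, c) = int k}"
    by (rule card_inj_on_le[where f = Suc]) (auto simp: M_array_def power2_eq_square)
  also have "\<dots> = p"
    using card_column_occurrences[of p c "int k"] assms(1) c k by simp
  finally show "card {s. s < p * p - 1 \<and> c \<in> M_array p k s} \<le> p" .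
qed

theorem theorem1:
  fixes p :: nat
  assumes "prime p" and "p \<ge> 3"
  shows
    "(\<forall>r<p\<^sup>2. \<forall>a\<in>{0..<int p}. card {c. c < p\<^sup>2 \<and> M p $$ (r, c) = a} = p) \<and>
     (\<forall>c<p\<^sup>2. \<forall>a\<in>{0..<int p}. card {r. r < p\<^sup>2 \<and> M p $$ (r, c) = a} = p) \<and>
     (\<forall>i<p. \<forall>c\<in>V p i. \<forall>d\<in>V p i. c \<noteq> d \<longrightarrow> card (agreements p c d) = p) \<and>
     (\<forall>i j. i < j \<and> j \<le> p - 1 \<longrightarrow>
        (\<forall>c\<in>V p i. \<forall>d\<in>V p j. card (agreements p c d) = p - 1)) \<and>
     gbtd_array p p {..<p\<^sup>2} (array_blocks p (p\<^sup>2 - 1) (M_array p)) (M_array p) \<and>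
     (\<exists>(X :: nat set) A. gbtd p p X A)"
proof (intro conjI allI ballI impI)
  show "card (agreements p c d) = p - 1"
    if "i < j \<and> j \<le> p - 1" "c \<in> V p i" "d \<in> V p j" for i j c d
    using card_agreements_distinct_blocks[of p i j c d] that assms by linarith
  show "gbtd_array p p {..<p\<^sup>2} (array_blocks p (p\<^sup>2 - 1) (M_array p)) (M_array p)"
    using gbtd_array_M_array[OF assms] .
  then show "\<exists>(X :: nat set) A. gbtd p p X A"
    unfolding gbtd_def by blast
qed (use assms in \<open>simp_all add: card_row_occurrences card_column_occurrences
      card_agreements_same_block\<close>)

end
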